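(* Let $K$ be an infinite field, $P=K[x_1,\dots,x_n]$, and let $\mathcal{L}$ be a distraction matrix with entries in $P_1$. Let $$\bigoplus_{i=1}^{r''}P(-t_i'')\xrightarrow{\ \psi\ }\bigoplus_{i=1}^{r}P(-t_i)\xrightarrow{\ \phi\ }\bigoplus_{i=1}^{r'}P(-t_i')$$ be a complex of $\mathbb{I}$-graded free $P$-modules and $\mathbb{I}$-graded homomorphisms, where $t_i'',t_i,t_i'$ are power products of standard degrees $d_i'',d_i,d_i'$. (a) The diagram of $K$-vector spaces with top row $$\bigoplus_{i=1}^{r''}P(-t_i'')\xrightarrow{\ \psi\ }\bigoplus_{i=1}^{r}P(-t_i)\xrightarrow{\ \phi\ }\bigoplus_{i=1}^{r'}P(-t_i'),$$ with bottom row $$\bigoplus_{i=1}^{r''}P(-d_i'')\xrightarrow{D_{\mathcal{L}}(\psi)}\bigoplus_{i=1}^{r}P(-d_i)\xrightarrow{D_{\mathcal{L}}(\phi)}\bigoplus_{i=1}^{r'}P(-d_i'),$$ and with vertical maps $D_{\mathcal{L}}$, is commutative. (b) $D_{\mathcal{L}}(\mathrm{Ker}(\phi))=\mathrm{Ker}(D_{\mathcal{L}}(\phi))$ and $D_{\mathcal{L}}(\mathrm{Im}(\phi))=\mathrm{Im}(D_{\mathcal{L}}(\phi))$. (c) The map $D_{\mathcal{L}}:\bigoplus_{i=1}^rP(-t_i)\to\bigoplus_{i=1}^rP(-d_i)$ induces a $K$-linear map $$\overline{D}_{\mathcal{L}}:\mathrm{Ker}(\phi)/\mathrm{Im}(\psi)\to\mathrm{Ker}(D_{\mathcal{L}}(\phi))/\mathrm{Im}(D_{\mathcal{L}}(\psi))$$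 which is compatible with the standard degree. (d) The map $\overline{D}_{\mathcal{L}}$ is an isomorphism of vector spaces.
   Context: A distraction matrix is an infinite matrix $\mathcal{L}=(L_{ij}\mid i=1,\dots,n,\ j\ge 1)$ with $L_{ij}\in P_1$ (linear forms) such that (i) $\langle L_{1j_1},\dots,L_{nj_n}\rangle=P_1$ ($K$-linear span) for all $j_1,\dots,j_n\ge 1$; (ii) there is $N$ with $L_{ij}=L_{iN}$ for all $i$ and all $j>N$. For a power product $t=x_1^{\alpha_1}\cdots x_n^{\alpha_n}$ put $D_{\mathcal{L}}(t)=\prod_{i=1}^n\prod_{j=1}^{\alpha_i}L_{ij}$ and extend $D_{\mathcal{L}}$ to $P$ by $K$-linearity. If $t_1\mid t_2$ then $D_{\mathcal{L}}(t_1)\mid D_{\mathcal{L}}(t_2)$. $\mathbb{I}$-graded means $\mathbb{Z}^n$-graded with respect to the fine grading $\deg(x_i)=$ the $i$-th standard basis vector; multidegrees $\log(t)\in\mathbb{N}^n$ are identified with power products $t$, and $P(-t)$ is the $\mathbb{I}$-graded free module on a generator of multidegree $t$. Homomorphisms of graded modules are degree-preserving. $P(-d)$ is the standard graded free module on a generator of degree $d$. For an $\mathbb{I}$-graded free module $\bigoplus_{i=1}^rP(-t_i)$ with basis $e_1,\dots,e_r$ and $d_i=\deg(t_i)$, the map $D_{\mathcal{L}}:\bigoplus_iP(-t_i)\to\bigoplus_iP(-d_i)$ is the $K$-linear map with $t\,e_i\mapsto \frac{D_{\mathcal{L}}(t\,t_i)}{D_{\mathcal{L}}(t_i)}\,e_i$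 for every power product $t$. "Standard degree" on $\bigoplus_iP(-t_i)$ is the total degree with $\deg e_i=d_i$. Notation: $f::g$ means $f/g$ if $g$ divides $f$, and $0$ otherwise. An $\mathbb{I}$-graded homomorphism $\phi:\bigoplus_{i=1}^rP(-t_i)\to\bigoplus_{i=1}^{r'}P(-t_i')$ is represented in the canonical bases by a matrix of the form $(c_{ij}\,(t_j::t_i'))$ with $c_{ij}\in K$ (column $j$ gives $\phi(e_j)$), and $D_{\mathcal{L}}(\phi):\bigoplus_iP(-d_i)\to\bigoplus_iP(-d_i')$ is the $P$-linear map represented by $(c_{ij}\,(D_{\mathcal{L}}(t_j)::D_{\mathcal{L}}(t_i')))$. $D_{\mathcal{L}}(\psi)$ is defined likewise. *)

theory Defs
  imports "HOL-Library.Poly_Mapping" "HOL-Algebra.AbelCoset" "Jordan_Normal_Form.VS_Connect"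
begin

text \<open>
  The variables are indexed by a finite linearly ordered type \<open>'n\<close>, standing for
  \<open>{1, ..., n}\<close>. A power product is its exponent vector \<open>log(t)\<close>, so multiplication of power
  products is addition of exponent vectors. The order on \<open>'n\<close> is only there to make the
  library's integral domain instance for \<open>\<Rightarrow>\<^sub>0\<close> available.
\<close>

type_synonym 'n pp = "'n \<Rightarrow>\<^sub>0 nat"
type_synonym ('n, 'k) mpoly = "('n \<Rightarrow>\<^sub>0 nat) \<Rightarrow>\<^sub>0 'k"

definition Const :: "'k::zero \<Rightarrow> ('n, 'k) mpoly" where
  "Const c = Poly_Mapping.single 0 c"

definition pp_poly :: "'n pp \<Rightarrow> ('n, 'k::zero_neq_one) mpoly" where
  "pp_poly t = Poly_Mapping.single t 1"

definition pp_deg :: "('n::finite) pp \<Rightarrow> nat" where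
  "pp_deg t = (\<Sum>i\<in>UNIV. Poly_Mapping.lookup t i)"

definition linear_forms :: "('n::finite, 'k::zero) mpoly set" where
  "linear_forms = {p. \<forall>t\<in>Poly_Mapping.keys p. pp_deg t = 1}"

global_interpretation mpoly: vector_space
  "\<lambda>(c::'k::field) (p::('n, 'k) mpoly). Const c * p"
  by unfold_locales
    (simp_all add: Const_def distrib_left distrib_right single_add mult_single flip: mult.assoc)

text \<open>
  The entries \<open>L i j\<close> of the matrix are those with \<open>j \<ge> 1\<close>; the value \<open>L i 0\<close> is irrelevant.
\<close>

definition distraction_matrix ::
    "('n::{finite,linorder} \<Rightarrow> nat \<Rightarrow> ('n, 'k::field) mpoly) \<Rightarrow> bool" where
  "distraction_matrix L \<longleftrightarrow>
     (\<forall>i. \<forall>j\<ge>1. L i j \<in> linear_forms) \<and>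
     (\<forall>js. (\<forall>i. js i \<ge> 1) \<longrightarrow> mpoly.span {L i (js i) | i. True} = linear_forms) \<and>
     (\<exists>N\<ge>1. \<forall>i. \<forall>j>N. L i j = L i N)"

definition distraction_pp ::
    "('n::finite \<Rightarrow> nat \<Rightarrow> ('n, 'k::field) mpoly) \<Rightarrow> 'n pp \<Rightarrow> ('n, 'k) mpoly" where
  "distraction_pp L t = (\<Prod>i\<in>UNIV. \<Prod>j = 1..Poly_Mapping.lookup t i. L i j)"

text \<open>The operation \<open>f :: g\<close>; only used for \<open>g \<noteq> 0\<close>, where the quotient is unique.\<close>

definition quot_or_zero :: "'a::comm_ring_1 \<Rightarrow> 'a \<Rightarrow> 'a" (infixl \<open>div0\<close> 70) where
  "f div0 g = (if g dvd f then (THE q. f = q * g) else 0)"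

text \<open>
  The underlying module of a graded free module of rank \<open>r\<close> is the module \<open>P\<^sup>r\<close> of column vectors,
  regarded either over \<open>P\<close> or over \<open>K\<close>. The shifts are kept separately, as a list \<open>ts\<close> of power
  products or a list \<open>ds\<close> of standard degrees, and enter through the notions of homogeneous
  element below. Homogeneous elements of a multidegree outside the nonnegative orthant are zero,
  so only multidegrees that are power products are mentioned.
\<close>

abbreviation free_mod ::
    "nat \<Rightarrow> (('n::{finite,linorder}, 'k::field) mpoly, ('n, 'k) mpoly vec) module" where
  "free_mod r \<equiv> module_vec TYPE(('n, 'k) mpoly) r"

definition free_space ::
    "nat \<Rightarrow> ('k::field, ('n::{finite,linorder}, 'k) mpoly vec) module" where
  "free_space r = \<lparr>carrier = carrier_vec r, mult = undefined, one = undefined,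
     zero = 0\<^sub>v r, add = (+), smult = (\<lambda>c v. Const c \<cdot>\<^sub>v v)\<rparr>"

definition fine_homogeneous ::
    "'n pp list \<Rightarrow> 'n pp \<Rightarrow> ('n::{finite,linorder}, 'k::field) mpoly vec \<Rightarrow> bool" where
  "fine_homogeneous ts m v \<longleftrightarrow> v \<in> carrier_vec (length ts) \<and>
     (\<forall>i<length ts. \<forall>s\<in>Poly_Mapping.keys (v $ i). s + ts ! i = m)"

definition std_homogeneous ::
    "nat list \<Rightarrow> nat \<Rightarrow> ('n::{finite,linorder}, 'k::field) mpoly vec \<Rightarrow> bool" where
  "std_homogeneous ds d v \<longleftrightarrow> v \<in> carrier_vec (length ds) \<and>
     (\<forall>i<length ds. \<forall>s\<in>Poly_Mapping.keys (v $ i). pp_deg s + ds ! i = d)"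

definition graded_hom :: "'n pp list \<Rightarrow> 'n pp list \<Rightarrow>
    (('n::{finite,linorder}, 'k::field) mpoly vec \<Rightarrow> ('n, 'k) mpoly vec) \<Rightarrow> bool" where
  "graded_hom ts ts' \<phi> \<longleftrightarrow>
     \<phi> \<in> LinearCombinations.module_hom class_ring (free_mod (length ts)) (free_mod (length ts')) \<and>
     (\<forall>m v. fine_homogeneous ts m v \<longrightarrow> fine_homogeneous ts' m (\<phi> v))"

text \<open>
  The scalar \<open>c\<^sub>i\<^sub>j\<close> in the representing matrix of \<open>\<phi>\<close>, see \<open>graded_hom_matrix\<close> below. If \<open>t'\<^sub>i\<close> does
  not divide \<open>t\<^sub>j\<close> the scalar is irrelevant (and the subtraction truncated).
\<close>

definition hom_coeff :: "'n pp list \<Rightarrow> 'n pp list \<Rightarrow>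
    (('n::{finite,linorder}, 'k::field) mpoly vec \<Rightarrow> ('n, 'k) mpoly vec) \<Rightarrow> nat \<Rightarrow> nat \<Rightarrow> 'k" where
  "hom_coeff ts ts' \<phi> i j =
     Poly_Mapping.lookup (\<phi> (unit_vec (length ts) j) $ i) (ts ! j - ts' ! i)"

lemma pp_poly_dvd_iff:
  "(pp_poly s :: ('n::{finite,linorder}, 'k::field) mpoly) dvd pp_poly t \<longleftrightarrow> (\<exists>u. t = u + s)"
proof
  assume "(pp_poly s :: ('n, 'k) mpoly) dvd pp_poly t"
  then obtain q :: "('n, 'k) mpoly" where q: "pp_poly t = pp_poly s * q" by (elim dvdE)
  have "t \<in> Poly_Mapping.keys (pp_poly t :: ('n, 'k) mpoly)" by (simp add: pp_poly_def)
  also have "\<dots> \<subseteq> {a + b | a b. a \<in> Poly_Mapping.keys (pp_poly s :: ('n, 'k) mpoly) \<and>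
      b \<in> Poly_Mapping.keys q}"
    unfolding q by (rule keys_mult)
  finally show "\<exists>u. t = u + s" by (auto simp: pp_poly_def add.commute)
next
  assume "\<exists>u. t = u + s"
  then obtain u where "t = u + s" by blast
  then have "(pp_poly t :: ('n, 'k) mpoly) = pp_poly s * pp_poly u"
    by (simp add: pp_poly_def mult_single add.commute)
  then show "(pp_poly s :: ('n, 'k) mpoly) dvd pp_poly t" by simp
qed

lemma div0_eq:
  fixes g :: "'a::idom"
  assumes "g \<noteq> 0"
  shows "(q * g) div0 g = q"
  using assms by (auto simp: quot_or_zero_def)

lemma graded_hom_matrix:
  fixes \<phi> :: "('n::{finite,linorder}, 'k::field) mpoly vec \<Rightarrow> ('n, 'k) mpoly vec"
  assumes "graded_hom ts ts' \<phi>" "j < length ts" "i < length ts'"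
  shows "\<phi> (unit_vec (length ts) j) $ i =
    Const (hom_coeff ts ts' \<phi> i j) * (pp_poly (ts ! j) div0 pp_poly (ts' ! i))"
proof -
  let ?p = "\<phi> (unit_vec (length ts) j) $ i"
  have "fine_homogeneous ts (ts ! j) (unit_vec (length ts) j :: ('n, 'k) mpoly vec)"
    using assms(2) by (auto simp: fine_homogeneous_def unit_vec_def split: if_splits)
  then have "fine_homogeneous ts' (ts ! j) (\<phi> (unit_vec (length ts) j))"
    using assms(1) by (simp add: graded_hom_def)
  then have *: "s + ts' ! i = ts ! j" if "s \<in> Poly_Mapping.keys ?p" for s
    using that assms(3) by (auto simp: fine_homogeneous_def)
  show ?thesis
  proof (cases "\<exists>u. ts ! j = u + ts' ! i")
    case True
    then obtain u where u: "ts ! j = u + ts' ! i" by blast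
    have "Poly_Mapping.keys ?p \<subseteq> {u}" using * u by auto
    then have "?p = Poly_Mapping.single u (Poly_Mapping.lookup ?p u)"
      by (intro poly_mapping_eqI) (auto simp: lookup_single when_def in_keys_iff)
    moreover have "(pp_poly (ts ! j) :: ('n, 'k) mpoly) div0 pp_poly (ts' ! i) = pp_poly u"
    proof -
      have "(pp_poly (ts ! j) :: ('n, 'k) mpoly) = pp_poly u * pp_poly (ts' ! i)"
        by (simp add: u pp_poly_def mult_single)
      moreover have "(pp_poly (ts' ! i) :: ('n, 'k) mpoly) \<noteq> 0"
        by (metis pp_poly_def lookup_single_eq lookup_zero zero_neq_one)
      ultimately show ?thesis by (metis div0_eq)
    qed
    ultimately show ?thesis
      by (simp add: hom_coeff_def u Const_def pp_poly_def mult_single)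
  next
    case False
    then have "Poly_Mapping.keys ?p = {}" using * by (metis ex_in_conv)
    then have "?p = 0" by (simp add: keys_eq_empty)
    moreover have "\<not> (pp_poly (ts' ! i) :: ('n, 'k) mpoly) dvd pp_poly (ts ! j)"
      using False by (simp add: pp_poly_dvd_iff)
    ultimately show ?thesis by (simp add: quot_or_zero_def)
  qed
qed

definition distraction_hom ::
    "('n::{finite,linorder} \<Rightarrow> nat \<Rightarrow> ('n, 'k::field) mpoly) \<Rightarrow> 'n pp list \<Rightarrow> 'n pp list \<Rightarrow>
     (('n, 'k) mpoly vec \<Rightarrow> ('n, 'k) mpoly vec) \<Rightarrow> ('n, 'k) mpoly vec \<Rightarrow> ('n, 'k) mpoly vec" where
  "distraction_hom L ts ts' \<phi> v =
     mat (length ts') (length ts) (\<lambda>(i, j).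
       Const (hom_coeff ts ts' \<phi> i j) *
         (distraction_pp L (ts ! j) div0 distraction_pp L (ts' ! i))) *\<^sub>v v"

definition distraction_free ::
    "('n::{finite,linorder} \<Rightarrow> nat \<Rightarrow> ('n, 'k::field) mpoly) \<Rightarrow> 'n pp list \<Rightarrow>
     ('n, 'k) mpoly vec \<Rightarrow> ('n, 'k) mpoly vec" where
  "distraction_free L ts v = vec (length ts) (\<lambda>i.
     \<Sum>t\<in>Poly_Mapping.keys (v $ i). Const (Poly_Mapping.lookup (v $ i) t) *
       (distraction_pp L (t + ts ! i) div0 distraction_pp L (ts ! i)))"

definition hom_ker :: "nat \<Rightarrow> nat \<Rightarrow>
    (('n::{finite,linorder}, 'k::field) mpoly vec \<Rightarrow> ('n, 'k) mpoly vec) \<Rightarrow> ('n, 'k) mpoly vec set" where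
  "hom_ker r r' \<phi> = mod_hom.ker (free_mod r) (free_mod r') \<phi>"

definition hom_im :: "nat \<Rightarrow>
    (('n::{finite,linorder}, 'k::field) mpoly vec \<Rightarrow> ('n, 'k) mpoly vec) \<Rightarrow> ('n, 'k) mpoly vec set" where
  "hom_im r \<phi> = mod_hom.im (free_mod r) \<phi>"

definition quot_space :: "('k, 'v, 'm) module_scheme \<Rightarrow> 'v set \<Rightarrow> ('k, 'v set) module" where
  "quot_space V B = \<lparr>carrier = a_rcosets\<^bsub>V\<^esub> B, mult = undefined, one = undefined,
     zero = B, add = set_add V, smult = (\<lambda>c X. \<Union>x\<in>X. B +>\<^bsub>V\<^esub> (c \<odot>\<^bsub>V\<^esub> x))\<rparr>"

text \<open>The \<open>K\<close>-vector space \<open>Z / B\<close> for subspaces \<open>B \<subseteq> Z\<close> of \<open>P\<^sup>r\<close>, and its component of standard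
  degree \<open>d\<close>.\<close>

abbreviation sub_space :: "nat \<Rightarrow> ('n::{finite,linorder}, 'k::field) mpoly vec set \<Rightarrow>
    ('k, ('n, 'k) mpoly vec) module" where
  "sub_space r Z \<equiv> (free_space r)\<lparr>carrier := Z\<rparr>"

abbreviation subquotient :: "nat \<Rightarrow> ('n::{finite,linorder}, 'k::field) mpoly vec set \<Rightarrow>
    ('n, 'k) mpoly vec set \<Rightarrow> ('k, ('n, 'k) mpoly vec set) module" where
  "subquotient r Z B \<equiv> quot_space (sub_space r Z) B"

definition subquotient_component :: "nat list \<Rightarrow> ('n::{finite,linorder}, 'k::field) mpoly vec set \<Rightarrow>
    ('n, 'k) mpoly vec set \<Rightarrow> nat \<Rightarrow> ('n, 'k) mpoly vec set set" where
  "subquotient_component ds Z B d =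
     {B +>\<^bsub>free_space (length ds)\<^esub> v | v. v \<in> Z \<and> std_homogeneous ds d v}"

text \<open>For \<open>X \<in> Z / B\<close>, the class modulo \<open>B'\<close> of the images under \<open>f\<close> of the elements of \<open>X\<close>.\<close>

definition induced_map :: "nat \<Rightarrow> ('n::{finite,linorder}, 'k::field) mpoly vec set \<Rightarrow>
    (('n, 'k) mpoly vec \<Rightarrow> ('n, 'k) mpoly vec) \<Rightarrow>
    ('n, 'k) mpoly vec set \<Rightarrow> ('n, 'k) mpoly vec set" where
  "induced_map r B' f X = (\<Union>x\<in>X. B' +>\<^bsub>free_space r\<^esub> f x)"

end

theory Submission
  imports Defs
begin

text \<open>
  The key point is that every \<open>D\<close> is a bijective \<open>K\<close>-linear map. On \<open>P\<close>, the polynomials \<open>D(t)\<close>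
  with \<open>deg t = m\<close> span the forms of degree \<open>m\<close>, by induction on \<open>m\<close>; since there are as many of
  them as power products of degree \<open>m\<close>, they form a basis. The \<open>i\<close>-th component of \<open>D\<close> on a free module
  is again a distraction of \<open>P\<close>, for the matrix whose rows are shifted by the exponents of \<open>t\<^sub>i\<close>.
  Commutativity of the diagram then reduces to the multiplicativity of \<open>D\<close> on basis elements, and a
  bijective morphism of complexes maps kernels, images and homology bijectively to each other.
\<close>

section \<open>Distraction of polynomials\<close>

text \<open>Dropping the first \<open>lookup s i\<close> entries of row \<open>i\<close> gives the
  matrix that governs the quotients D(s t)/D(s), see \<open>distraction_pp_add\<close>.\<close>

abbreviation shift_matrix :: "('n \<Rightarrow> nat \<Rightarrow> 'a) \<Rightarrow> 'n pp \<Rightarrow> 'n \<Rightarrow> nat \<Rightarrow> 'a" where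
  "shift_matrix L s \<equiv> \<lambda>i j. L i (j + Poly_Mapping.lookup s i)"

lemma shift_matrix_shift: "shift_matrix (shift_matrix L s) t = shift_matrix L (t + s)"
  by (auto simp: lookup_add add.assoc intro!: ext)

text \<open>The spanning condition allows an independent choice of column in each row, so shifting
  every row by its own amount preserves it; the index after which the rows are constant stays
  valid.\<close>

lemma distraction_matrix_shift:
  assumes "distraction_matrix L"
  shows "distraction_matrix (shift_matrix L s)"
proof -
  obtain N where N: "N \<ge> 1" "\<And>i j. j > N \<Longrightarrow> L i j = L i N"
    using assms by (auto simp: distraction_matrix_def)
  \<comment> \<open>\<open>N(2)\<close> needs an index strictly beyond \<open>N\<close>. In an
    unshifted row the right-hand index is \<open>N\<close> itself, and the claim is then
    \<open>N(2)\<close> for \<open>j\<close>.\<close>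
  have "L i (j + Poly_Mapping.lookup s i) = L i (N + Poly_Mapping.lookup s i)" if "j > N" for i j
    using N(2)[of "j + Poly_Mapping.lookup s i" i] N(2)[of "N + Poly_Mapping.lookup s i" i] that
    by (cases "Poly_Mapping.lookup s i = 0") auto
  then show ?thesis
    using assms N(1) unfolding distraction_matrix_def
    by (auto intro!: exI[of _ N] simp: trans_le_add1)
qed

lemma pp_deg_add: "pp_deg (s + t) = pp_deg s + pp_deg t"
  by (simp add: pp_deg_def lookup_add sum.distrib)

lemma pp_deg_single [simp]: "pp_deg (Poly_Mapping.single i k) = k"
  by (simp add: pp_deg_def lookup_single when_def)

lemma pp_deg_eq_SucE:
  fixes t :: "('n::finite) pp"
  assumes "pp_deg t = Suc m"
  obtains i s where "t = Poly_Mapping.single i 1 + s" "pp_deg s = m"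
proof -
  from assms obtain i where i: "Poly_Mapping.lookup t i \<noteq> 0"
    unfolding pp_deg_def by (metis nat.distinct(1) sum.neutral)
  have eq: "t = Poly_Mapping.single i 1 + (t - Poly_Mapping.single i 1)"
    using i by (intro poly_mapping_eqI) (auto simp: lookup_add lookup_minus lookup_single when_def)
  moreover have "pp_deg (t - Poly_Mapping.single i 1) = m"
    using assms pp_deg_add[of "Poly_Mapping.single i 1" "t - Poly_Mapping.single i 1"] eq by simp
  ultimately show thesis by (rule that)
qed

lemma finite_pp_deg_le: "finite {t :: ('n::finite) pp. pp_deg t \<le> m}"
proof -
  have "Poly_Mapping.lookup ` {t :: 'n pp. pp_deg t \<le> m} \<subseteq> PiE UNIV (\<lambda>_. {..m})"
  proof
    fix f :: "'n \<Rightarrow> nat"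
    assume "f \<in> Poly_Mapping.lookup ` {t. pp_deg t \<le> m}"
    then obtain t where t: "f = Poly_Mapping.lookup t" "pp_deg t \<le> m" by auto
    have "Poly_Mapping.lookup t i \<le> pp_deg t" for i
      unfolding pp_deg_def by (rule member_le_sum) auto
    with t show "f \<in> PiE UNIV (\<lambda>_. {..m})" using le_trans by fastforce
  qed
  moreover have "finite (PiE (UNIV :: 'n set) (\<lambda>_. {..m}))" by (intro finite_PiE) auto
  moreover have "inj_on Poly_Mapping.lookup {t :: 'n pp. pp_deg t \<le> m}"
    by (simp add: inj_on_def flip: poly_mapping_eq_iff)
  ultimately show ?thesis by (metis finite_imageD finite_subset)
qed

lemma pp_poly_mult: "pp_poly s * pp_poly t = (pp_poly (s + t) :: ('n, 'k::field) mpoly)"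
  by (simp add: pp_poly_def mult_single)

text \<open>In each row the product of entries splits after the part belonging to \<open>s\<close>.
  So D is multiplicative up to a shift of the matrix, and D(s) divides D(s t).\<close>

lemma distraction_pp_add:
  "distraction_pp L (s + t) = distraction_pp L s * distraction_pp (shift_matrix L s) t"
proof -
  have "(\<Prod>j = 1..a + b. f j) = (\<Prod>j = 1..a. f j) * (\<Prod>j = 1..b. f (j + a))"
    for a b and f :: "nat \<Rightarrow> ('a, 'b) mpoly"
    by (induction b) (simp_all add: mult.assoc add.commute)
  then show ?thesis by (simp add: distraction_pp_def lookup_add prod.distrib)
qed

lemma distraction_pp_single: "distraction_pp L (Poly_Mapping.single i 1) = L i 1"
proof -
  have "distraction_pp L (Poly_Mapping.single i 1) = (\<Prod>k\<in>UNIV. if k = i then L i 1 else 1)"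
    unfolding distraction_pp_def by (intro prod.cong) (auto simp: lookup_single when_def)
  then show ?thesis by simp
qed

text \<open>Multiplication is bilinear over K, so checking generators suffices: span induction first
  in \<open>x\<close>, then in \<open>y\<close>.\<close>

lemma span_mult_closed:
  fixes A B C :: "('n, 'k::field) mpoly set"
  assumes x: "x \<in> mpoly.span A" and y: "y \<in> mpoly.span B"
    and AB: "\<And>a b. a \<in> A \<Longrightarrow> b \<in> B \<Longrightarrow> a * b \<in> mpoly.span C"
  shows "x * y \<in> mpoly.span C"
  using x
proof (induction rule: mpoly.span_induct_alt)
  case base
  show ?case by (simp add: mpoly.span_zero)
next
  case (step c a z)
  from y have "a * y \<in> mpoly.span C"
  proof (induction rule: mpoly.span_induct_alt)
    case base
    show ?case by (simp add: mpoly.span_zero)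
  next
    case (step d b w)
    have "a * (Const d * b + w) = Const d * (a * b) + a * w"
      by (simp add: algebra_simps)
    then show ?case using step \<open>a \<in> A\<close> by (simp add: AB mpoly.span_add mpoly.span_scale)
  qed
  moreover have "(Const c * a + z) * y = Const c * (a * y) + z * y"
    by (simp add: algebra_simps)
  ultimately show ?case using step by (simp add: mpoly.span_add mpoly.span_scale)
qed

text \<open>
  Write \<open>t = x\<^sub>i s\<close> and expand \<open>x\<^sub>i\<close> in the first column of the matrix; the cofactor \<open>s\<close> of the \<open>k\<close>-th
  entry is then expanded with respect to the matrix whose \<open>k\<close>-th row is shifted by one.
\<close>

lemma pp_poly_in_span_distraction_pp:
  fixes L :: "'n::{finite,linorder} \<Rightarrow> nat \<Rightarrow> ('n, 'k::field) mpoly"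
  assumes "distraction_matrix L" "pp_deg t = m"
  shows "pp_poly t \<in> mpoly.span (distraction_pp L ` {s. pp_deg s = m})"
  using assms
proof (induction m arbitrary: L t)
  case 0
  then have "t = 0" by (intro poly_mapping_eqI) (auto simp: pp_deg_def)
  then have "pp_poly t = distraction_pp L t"
    by (simp add: pp_poly_def distraction_pp_def)
  then show ?case using 0 by (auto intro!: mpoly.span_base)
next
  case (Suc m)
  obtain i s where t: "t = Poly_Mapping.single i 1 + s" "pp_deg s = m"
    using Suc.prems(2) by (rule pp_deg_eq_SucE)
  let ?C = "distraction_pp L ` {s. pp_deg s = Suc m}"
  have *: "L k 1 * pp_poly s \<in> mpoly.span ?C" for k
  proof -
    let ?L = "shift_matrix L (Poly_Mapping.single k 1)"
    have "pp_poly s \<in> mpoly.span (distraction_pp ?L ` {s. pp_deg s = m})"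
      using Suc.prems(1) t(2) by (intro Suc.IH distraction_matrix_shift)
    moreover have "L k 1 * b \<in> mpoly.span ?C" if b: "b \<in> distraction_pp ?L ` {s. pp_deg s = m}" for b
    proof -
      from b obtain u where u: "b = distraction_pp ?L u" "pp_deg u = m" by auto
      then have "L k 1 * b = distraction_pp L (Poly_Mapping.single k 1 + u)"
        by (simp only: distraction_pp_add distraction_pp_single)
      with u(2) show ?thesis by (intro mpoly.span_base) (simp add: pp_deg_add)
    qed
    ultimately show ?thesis
      by (intro span_mult_closed[of "L k 1" "{L k 1}"]) (simp_all add: mpoly.span_base)
  qed
  have "mpoly.span {L k 1 |k. True} = linear_forms"
  proof -
    have "\<forall>js. (\<forall>k. js k \<ge> 1) \<longrightarrow> mpoly.span {L k (js k) |k. True} = linear_forms"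
      using Suc.prems(1) unfolding distraction_matrix_def by blast
    from spec[OF this, of "\<lambda>_. 1"] show ?thesis by (rule mp) simp
  qed
  moreover have "pp_poly (Poly_Mapping.single i 1) \<in> (linear_forms :: ('n, 'k) mpoly set)"
    unfolding linear_forms_def pp_poly_def by simp
  ultimately have "pp_poly (Poly_Mapping.single i 1) \<in> mpoly.span {L k 1 |k. True}" by simp
  then have "pp_poly (Poly_Mapping.single i 1) * pp_poly s \<in> mpoly.span ?C"
  proof (rule span_mult_closed)
    show "pp_poly s \<in> mpoly.span {pp_poly s :: ('n, 'k) mpoly}" by (simp add: mpoly.span_base)
    fix a b :: "('n, 'k) mpoly"
    assume "a \<in> {L k 1 |k. True}" "b \<in> {pp_poly s}"
    then show "a * b \<in> mpoly.span ?C" using * by blast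
  qed
  then show ?case by (simp only: t(1) pp_poly_mult)
qed

section \<open>Linear extension to polynomials and its bijectivity\<close>

definition distraction_poly ::
    "('n::finite \<Rightarrow> nat \<Rightarrow> ('n, 'k::field) mpoly) \<Rightarrow> ('n, 'k) mpoly \<Rightarrow> ('n, 'k) mpoly" where
  "distraction_poly L p =
     (\<Sum>t\<in>Poly_Mapping.keys p. Const (Poly_Mapping.lookup p t) * distraction_pp L t)"

lemma Const_0 [simp]: "Const 0 = 0"
  and Const_add: "Const (a + b) = Const a + Const b"
  by (simp_all add: Const_def single_add)

lemma Const_mult: "Const (a * b) = (Const a * Const b :: ('n, 'k::field) mpoly)"
  by (simp add: Const_def mult_single)

lemma lookup_Const_mult:
  "Poly_Mapping.lookup (Const c * p :: ('n, 'k::field) mpoly) t = c * Poly_Mapping.lookup p t"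
  by (simp add: Const_def Poly_Mapping.map.rep_eq when_def flip: mult_map_scale_conv_mult)

text \<open>Cancellation can shrink the support of a sum. Padding with zero terms lets several
  polynomials share one index set, which is how linearity is proved.\<close>

lemma distraction_poly_eq_sum:
  assumes "finite S" "Poly_Mapping.keys p \<subseteq> S"
  shows "distraction_poly L p = (\<Sum>t\<in>S. Const (Poly_Mapping.lookup p t) * distraction_pp L t)"
  unfolding distraction_poly_def using assms
  by (intro sum.mono_neutral_left) (auto simp: in_keys_iff)

lemma distraction_poly_add:
  "distraction_poly L (p + q) = distraction_poly L p + distraction_poly L q"
proof -
  let ?S = "Poly_Mapping.keys p \<union> Poly_Mapping.keys q"
  have "distraction_poly L f = (\<Sum>t\<in>?S. Const (Poly_Mapping.lookup f t) * distraction_pp L t)"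
    if "Poly_Mapping.keys f \<subseteq> ?S" for f
    using that by (intro distraction_poly_eq_sum) simp_all
  note eq = this[of p, OF Un_upper1] this[of q, OF Un_upper2] this[of "p + q", OF keys_add]
  show ?thesis
    unfolding eq by (simp add: lookup_add Const_add distrib_right sum.distrib)
qed

lemma distraction_poly_Const_mult:
  "distraction_poly L (Const c * p) = Const c * distraction_poly L p"
proof -
  have "Poly_Mapping.keys (Const c * p) \<subseteq> Poly_Mapping.keys p"
    by (auto simp: in_keys_iff lookup_Const_mult)
  then have "distraction_poly L (Const c * p) =
      (\<Sum>t\<in>Poly_Mapping.keys p. Const (c * Poly_Mapping.lookup p t) * distraction_pp L t)"
    by (simp only: distraction_poly_eq_sum[OF finite_keys] lookup_Const_mult)
  then show ?thesis
    by (simp only: distraction_poly_def Const_mult sum_distrib_left mult.assoc)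
qed

lemma distraction_poly_pp_poly [simp]: "distraction_poly L (pp_poly t) = distraction_pp L t"
  by (simp add: distraction_poly_def pp_poly_def)

lemma distraction_poly_0 [simp]: "distraction_poly L 0 = 0"
  by (simp add: distraction_poly_def)

lemma distraction_poly_sum: "distraction_poly L (sum f S) = (\<Sum>x\<in>S. distraction_poly L (f x))"
  by (induction S rule: infinite_finite_induct) (simp_all add: distraction_poly_add)

text \<open>Supplies the facts on images of spans and on injectivity over independent sets that
  \<open>bij_distraction_poly\<close> uses.\<close>

interpretation distraction_poly:
  Vector_Spaces.linear "\<lambda>(c::'k::field) (p::('n::finite, 'k) mpoly). Const c * p"
    "\<lambda>c p. Const c * p" "distraction_poly L" for L
  by unfold_locales (simp_all add: distraction_poly_add distraction_poly_Const_mult)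

lemma mpoly_eq_sum_pp_poly:
  fixes p :: "('n, 'k::field) mpoly"
  shows "p = (\<Sum>t\<in>Poly_Mapping.keys p. Const (Poly_Mapping.lookup p t) * pp_poly t)"
proof -
  have "Const c * pp_poly t = (Poly_Mapping.single t c :: ('n, 'k) mpoly)" for c t
    by (simp add: Const_def pp_poly_def mult_single)
  then show ?thesis
    by (intro poly_mapping_eqI) (simp add: lookup_sum lookup_single when_def in_keys_iff)
qed

text \<open>Turns span membership into a condition on supports. It yields both the independence of
  the power products and the description of the polynomials of degree at most
  \<open>m\<close>.\<close>

lemma span_pp_poly:
  "mpoly.span (pp_poly ` S :: ('n, 'k::field) mpoly set) = {p. Poly_Mapping.keys p \<subseteq> S}"
proof (rule mpoly.span_unique)
  let ?X = "{p :: ('n, 'k) mpoly. Poly_Mapping.keys p \<subseteq> S}"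
  show "pp_poly ` S \<subseteq> ?X"
    by (auto simp: pp_poly_def)
  show "mpoly.subspace ?X"
  proof (rule mpoly.subspaceI)
    fix p q :: "('n, 'k) mpoly" and c
    assume p: "p \<in> ?X"
    then show "Const c * p \<in> ?X"
      by (auto simp: in_keys_iff lookup_Const_mult)
    assume "q \<in> ?X"
    with p show "p + q \<in> ?X" using keys_add[of p q] by auto
  qed simp
next
  fix V :: "('n, 'k) mpoly set"
  assume V: "pp_poly ` S \<subseteq> V" "mpoly.subspace V"
  show "{p. Poly_Mapping.keys p \<subseteq> S} \<subseteq> V"
  proof safe
    fix p :: "('n, 'k) mpoly"
    assume "Poly_Mapping.keys p \<subseteq> S"
    then have "(\<Sum>t\<in>Poly_Mapping.keys p. Const (Poly_Mapping.lookup p t) * pp_poly t) \<in> V"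
      using V(1) by (intro mpoly.subspace_sum mpoly.subspace_scale V(2)) auto
    then show "p \<in> V" by (simp flip: mpoly_eq_sum_pp_poly)
  qed
qed

text \<open>The linear extension of \<open>distraction_pp_add\<close>: a power product can be split
  off, but its cofactor is then distracted by the shifted matrix.\<close>

lemma distraction_poly_pp_poly_mult:
  "distraction_poly L (p * pp_poly u) = distraction_pp L u * distraction_poly (shift_matrix L u) p"
proof -
  have "distraction_poly L (p * pp_poly u) =
      distraction_poly L ((\<Sum>t\<in>Poly_Mapping.keys p. Const (Poly_Mapping.lookup p t) * pp_poly t) * pp_poly u)"
    by (subst mpoly_eq_sum_pp_poly[symmetric]) simp
  also have "\<dots> = (\<Sum>t\<in>Poly_Mapping.keys p. Const (Poly_Mapping.lookup p t) * distraction_pp L (u + t))"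
    by (simp add: sum_distrib_right mult.assoc pp_poly_mult distraction_poly_sum
        distraction_poly_Const_mult add.commute)
  also have "\<dots> = distraction_pp L u * distraction_poly (shift_matrix L u) p"
    by (simp add: distraction_poly_def distraction_pp_add sum_distrib_left mult.left_commute)
  finally show ?thesis .
qed

lemma inj_pp_poly: "inj (pp_poly :: _ \<Rightarrow> ('n, 'k::field) mpoly)"
  by (rule injI) (metis lookup_single_eq lookup_single_not_eq pp_poly_def zero_neq_one)

lemma independent_pp_poly: "mpoly.independent (pp_poly ` S :: ('n, 'k::field) mpoly set)"
proof
  assume "mpoly.dependent (pp_poly ` S :: ('n, 'k) mpoly set)"
  then obtain t where "pp_poly t \<in> mpoly.span (pp_poly ` S - {pp_poly t :: ('n, 'k) mpoly})"
    unfolding mpoly.dependent_def by auto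
  also have "pp_poly ` S - {pp_poly t :: ('n, 'k) mpoly} = pp_poly ` (S - {t})"
    using inj_pp_poly by (auto simp: inj_def)
  finally show False unfolding span_pp_poly by (simp add: pp_poly_def)
qed

text \<open>Passes from single degrees to the filtration by degree at most \<open>m\<close>, whose
  finite-dimensional steps exhaust P.\<close>

lemma pp_poly_subset_span_distraction_poly:
  fixes L :: "'n::{finite,linorder} \<Rightarrow> nat \<Rightarrow> ('n, 'k::field) mpoly"
  assumes "distraction_matrix L"
  shows "pp_poly ` {t. pp_deg t \<le> m} \<subseteq> mpoly.span (distraction_poly L ` pp_poly ` {t. pp_deg t \<le> m})"
proof safe
  fix t :: "'n pp"
  assume "pp_deg t \<le> m"
  then have "distraction_pp L ` {s. pp_deg s = pp_deg t} \<subseteq>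
      distraction_poly L ` pp_poly ` {t. pp_deg t \<le> m}"
    by (auto simp flip: distraction_poly_pp_poly)
  then show "pp_poly t \<in> mpoly.span (distraction_poly L ` pp_poly ` {t. pp_deg t \<le> m})"
    using pp_poly_in_span_distraction_pp[OF assms refl] mpoly.span_mono by blast
qed

lemma bij_distraction_poly:
  fixes L :: "'n::{finite,linorder} \<Rightarrow> nat \<Rightarrow> ('n, 'k::field) mpoly"
  assumes "distraction_matrix L"
  shows "bij (distraction_poly L)"
proof -
  define M :: "nat \<Rightarrow> ('n, 'k) mpoly set" where "M m = pp_poly ` {t. pp_deg t \<le> m}" for m
  let ?D = "distraction_poly L"
  have M: "M m \<subseteq> mpoly.span (?D ` M m)" for m
    unfolding M_def by (rule pp_poly_subset_span_distraction_poly[OF assms])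
  have ind: "mpoly.independent (M m)" and fin: "finite (M m)" for m
    by (simp_all add: M_def independent_pp_poly finite_pp_deg_le)
  have inj: "inj_on ?D (mpoly.span (M m))" for m
  proof -
    \<comment> \<open>Exchange bound: the independent set \<open>M m\<close> lies in the span of its
      image under \<open>?D\<close>, so the image has at least as many elements and no two elements
      of \<open>M m\<close> are identified.\<close>
    have card: "card (M m) \<le> card (?D ` M m)"
      using mpoly.independent_span_bound[of "?D ` M m" "M m"] M ind fin by simp
    then have "inj_on ?D (M m)"
      using fin by (simp add: card_image_le eq_card_imp_inj_on order_antisym)
    \<comment> \<open>A dependent image could lose one element without changing its span, which
      would still contain \<open>M m\<close> but be generated by fewer elements than
      \<open>M m\<close> has.\<close>
    moreover have "mpoly.independent (?D ` M m)"
    proof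
      assume "mpoly.dependent (?D ` M m)"
      then obtain b where b: "b \<in> ?D ` M m" "b \<in> mpoly.span (?D ` M m - {b})"
        unfolding mpoly.dependent_def by auto
      then have "mpoly.span (?D ` M m - {b}) = mpoly.span (?D ` M m)"
        using mpoly.span_redundant[OF b(2)] by (simp add: insert_absorb)
      then have "card (M m) \<le> card (?D ` M m - {b})"
        using mpoly.independent_span_bound[of "?D ` M m - {b}" "M m"] M ind fin by simp
      then show False
        using b(1) fin card by (metis card_Diff1_less card_image_le finite_imageI leD le_trans)
    qed
    ultimately show ?thesis by (intro distraction_poly.inj_on_span_independent_image)
  qed
  have mem: "p \<in> mpoly.span (M m)" if "\<forall>t\<in>Poly_Mapping.keys p. pp_deg t \<le> m" for p m
    using that by (auto simp: M_def span_pp_poly)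
  have bound: "\<exists>m. \<forall>t\<in>Poly_Mapping.keys p. pp_deg t \<le> m" for p :: "('n, 'k) mpoly"
    using finite_nat_set_iff_bounded_le[of "pp_deg ` Poly_Mapping.keys p"] by auto
  show ?thesis
  proof (rule bijI)
    show "inj ?D"
    proof (rule injI)
      fix p q assume "?D p = ?D q"
      moreover obtain m n where "\<forall>t\<in>Poly_Mapping.keys p. pp_deg t \<le> m"
        "\<forall>t\<in>Poly_Mapping.keys q. pp_deg t \<le> n" using bound by meson
      then have "p \<in> mpoly.span (M (max m n))" "q \<in> mpoly.span (M (max m n))"
        by (auto intro!: mem simp: le_max_iff_disj)
      ultimately show "p = q" using inj by (auto dest: inj_onD)
    qed
    \<comment> \<open>The span of the image of \<open>M m\<close> is the image of its span, so
      \<open>p\<close> has a preimage of degree at most \<open>m\<close>.\<close>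
    have "p \<in> range ?D" for p
    proof -
      obtain m where "p \<in> mpoly.span (M m)" using bound mem by meson
      also have "\<dots> \<subseteq> mpoly.span (?D ` M m)"
        using M by (rule mpoly.span_minimal) simp
      finally show ?thesis by (auto simp: distraction_poly.span_image)
    qed
    then show "surj ?D" by auto
  qed
qed

text \<open>Nonvanishing is read off from injectivity. It makes every D(t) a legitimate denominator
  for \<open>div0\<close>.\<close>

lemma distraction_pp_nonzero:
  fixes L :: "'n::{finite,linorder} \<Rightarrow> nat \<Rightarrow> ('n, 'k::field) mpoly"
  assumes "distraction_matrix L"
  shows "distraction_pp L t \<noteq> 0"
proof
  assume "distraction_pp L t = 0"
  then have "distraction_poly L (pp_poly t) = distraction_poly L 0" by simp
  then have "(pp_poly t :: ('n, 'k) mpoly) = 0"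
    by (rule injD[OF bij_is_inj[OF bij_distraction_poly[OF assms]]])
  then show False by (metis lookup_single_eq lookup_zero pp_poly_def zero_neq_one)
qed

section \<open>Quotient spaces\<close>

text \<open>Opens the coset calculus of additive subgroups to subspaces; closure under negation is
  multiplication by the scalar -1.\<close>

lemma subspace_imp_abelian_subgroup:
  fixes V (structure)
  assumes "vectorspace K V" "subspace K B V"
  shows "abelian_subgroup B V"
proof -
  interpret V: vectorspace K V by fact
  interpret B: submodule K B V using assms(2) by (simp add: subspace_def)
  have "subgroup B (add_monoid V)"
  proof (rule V.add.subgroupI)
    show "B \<subseteq> carrier V" by (rule B.subset)
    show "B \<noteq> {}" using B.zero_closed by blast
    show "\<ominus> a \<in> B" if "a \<in> B" for a
    proof -
      have "a \<in> carrier V" using that B.subset by blast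
      then have "\<ominus> a = (\<ominus>\<^bsub>K\<^esub> \<one>\<^bsub>K\<^esub>) \<odot> a" by (simp add: V.smult_minus_1)
      with that show ?thesis by simp
    qed
  qed (rule B.m_closed)
  then show ?thesis
    by (intro abelian_subgroupI3 additive_subgroupI V.abelian_group_axioms)
qed

lemma coset_eqI:
  fixes V (structure)
  assumes "vectorspace K V" "subspace K B V" "v \<in> carrier V" "x \<in> B +> v"
  shows "B +> x = B +> v"
proof -
  interpret V: vectorspace K V by fact
  interpret abelian_subgroup B V using assms(1,2) by (rule subspace_imp_abelian_subgroup)
  show ?thesis using V.a_repr_independence[OF assms(4,3) a_subgroup] by simp
qed

text \<open>Scalar multiplication in \<open>quot_space\<close> is a union over all representatives.
  They all give the same coset, so the union collapses.\<close>

lemma quot_space_smult_coset: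
  fixes V (structure)
  assumes "vectorspace K V" "subspace K B V" "c \<in> carrier K" "v \<in> carrier V"
  shows "c \<odot>\<^bsub>quot_space V B\<^esub> (B +> v) = B +> (c \<odot> v)"
proof -
  interpret V: vectorspace K V by fact
  interpret B: submodule K B V using assms(2) by (simp add: subspace_def)
  interpret abelian_subgroup B V using assms(1,2) by (rule subspace_imp_abelian_subgroup)
  have "B +> (c \<odot> x) = B +> (c \<odot> v)" if x: "x \<in> B +> v" for x
  proof -
    from x obtain b where b: "b \<in> B" "x = b \<oplus> v" by (auto simp: a_r_coset_def')
    then have "c \<odot> x = c \<odot> b \<oplus> c \<odot> v"
      using assms(3,4) B.subset by (auto simp: V.smult_r_distr)
    then have "c \<odot> x \<in> B +> (c \<odot> v)"
      using b(1) assms(3) by (auto simp: a_r_coset_def')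
    then show ?thesis
      using assms by (intro coset_eqI) auto
  qed
  then have "(\<Union>x\<in>B +> v. B +> (c \<odot> x)) = (\<Union>x\<in>B +> v. B +> (c \<odot> v))"
    by (rule SUP_cong[OF refl])
  moreover have "v \<in> B +> v" using assms(4) by (rule a_rcos_self)
  ultimately show ?thesis by (auto simp: quot_space_def)
qed

lemma vectorspace_quot_space:
  fixes V (structure)
  assumes "vectorspace K V" "subspace K B V"
  shows "vectorspace K (quot_space V B)"
proof -
  interpret V: vectorspace K V by fact
  interpret B: submodule K B V using assms(2) by (simp add: subspace_def)
  interpret abelian_subgroup B V using assms by (rule subspace_imp_abelian_subgroup)
  let ?Q = "quot_space V B"
  have coset_closed: "B +> v \<in> carrier ?Q" if "v \<in> carrier V" for v
    using that by (auto simp: quot_space_def A_RCOSETS_def')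
  have coset_cases: thesis if "X \<in> carrier ?Q" "\<And>v. v \<in> carrier V \<Longrightarrow> X = B +> v \<Longrightarrow> thesis" for X thesis
    using that by (auto simp: quot_space_def A_RCOSETS_def')
  have add: "(B +> v) \<oplus>\<^bsub>?Q\<^esub> (B +> w) = B +> (v \<oplus> w)" if "v \<in> carrier V" "w \<in> carrier V" for v w
    using that by (simp add: quot_space_def a_rcos_sum)
  note smult = quot_space_smult_coset[OF assms]
  have zero: "\<zero>\<^bsub>?Q\<^esub> = B +> \<zero>"
    by (simp add: quot_space_def B.subset)
  have "abelian_group ?Q"
  proof (rule abelian_groupI)
    fix X assume "X \<in> carrier ?Q"
    then obtain v where v: "v \<in> carrier V" "X = B +> v" by (rule coset_cases)
    then show "\<exists>Y\<in>carrier ?Q. Y \<oplus>\<^bsub>?Q\<^esub> X = \<zero>\<^bsub>?Q\<^esub>"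
      by (intro bexI[of _ "B +> (\<ominus> v)"]) (auto simp: add zero coset_closed V.l_neg)
  qed (auto elim!: coset_cases simp: coset_closed add zero V.a_ac)
  moreover have "module_axioms K ?Q"
    by unfold_locales (auto elim!: coset_cases simp: coset_closed add smult V.smult_l_distr V.smult_r_distr V.smult_assoc1)
  ultimately show ?thesis
    by (intro vectorspace.intro Module.module.intro V.R.cring_axioms V.field_axioms)
qed

text \<open>Well-definedness of the induced map: two representatives differ by an element of
  \<open>B\<close>, which \<open>T\<close> sends into \<open>B'\<close>, so all cosets in the union
  coincide.\<close>

lemma induced_map_coset:
  fixes V (structure) and V' (structure)
  assumes "linear_map K V V' T" "subspace K B V" "subspace K B' V'" "T ` B \<subseteq> B'" "v \<in> carrier V"
  shows "(\<Union>x\<in>B +>\<^bsub>V\<^esub> v. B' +>\<^bsub>V'\<^esub> T x) = B' +>\<^bsub>V'\<^esub> T v"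
proof -
  interpret T: linear_map K V V' T by fact
  interpret B: submodule K B V using assms(2) by (simp add: subspace_def)
  interpret B: abelian_subgroup B V
    using T.V.vectorspace_axioms assms(2) by (rule subspace_imp_abelian_subgroup)
  interpret B': abelian_subgroup B' V'
    using T.W.vectorspace_axioms assms(3) by (rule subspace_imp_abelian_subgroup)
  have "B' +>\<^bsub>V'\<^esub> T x = B' +>\<^bsub>V'\<^esub> T v" if x: "x \<in> B +>\<^bsub>V\<^esub> v" for x
  proof -
    from x obtain b where b: "b \<in> B" "x = b \<oplus>\<^bsub>V\<^esub> v" by (auto simp: a_r_coset_def')
    then have "T x = T b \<oplus>\<^bsub>V'\<^esub> T v"
      using assms(5) B.subset by auto
    then have "T x \<in> B' +>\<^bsub>V'\<^esub> T v"
      using b(1) assms(4) by (auto simp: a_r_coset_def')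
    with T.W.vectorspace_axioms assms(3) show ?thesis
      using assms(5) by (intro coset_eqI) auto
  qed
  then have "(\<Union>x\<in>B +>\<^bsub>V\<^esub> v. B' +>\<^bsub>V'\<^esub> T x) =
      (\<Union>x\<in>B +>\<^bsub>V\<^esub> v. B' +>\<^bsub>V'\<^esub> T v)"
    by (rule SUP_cong[OF refl])
  moreover have "v \<in> B +>\<^bsub>V\<^esub> v" using assms(5) by (rule B.a_rcos_self)
  ultimately show ?thesis by auto
qed

lemma linear_map_quot_space:
  fixes V (structure) and V' (structure)
  assumes T: "linear_map K V V' T" and B: "subspace K B V" and B': "subspace K B' V'"
    and "T ` B \<subseteq> B'"
  shows "linear_map K (quot_space V B) (quot_space V' B') (\<lambda>X. \<Union>x\<in>X. B' +>\<^bsub>V'\<^esub> T x)"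
    (is "linear_map K ?Q ?Q' ?f")
proof -
  interpret T: linear_map K V V' T by fact
  note vs = T.V.vectorspace_axioms T.W.vectorspace_axioms
  interpret B: abelian_subgroup B V using vs(1) B by (rule subspace_imp_abelian_subgroup)
  interpret B': abelian_subgroup B' V' using vs(2) B' by (rule subspace_imp_abelian_subgroup)
  note f = induced_map_coset[OF assms]
  have carrier: "X \<in> carrier ?Q \<longleftrightarrow> (\<exists>v\<in>carrier V. X = B +>\<^bsub>V\<^esub> v)"
    "Y \<in> carrier ?Q' \<longleftrightarrow> (\<exists>v\<in>carrier V'. Y = B' +>\<^bsub>V'\<^esub> v)" for X Y
    by (auto simp: quot_space_def A_RCOSETS_def')
  have add: "(B +>\<^bsub>V\<^esub> v) \<oplus>\<^bsub>?Q\<^esub> (B +>\<^bsub>V\<^esub> w) = B +>\<^bsub>V\<^esub> (v \<oplus>\<^bsub>V\<^esub> w)"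
    if "v \<in> carrier V" "w \<in> carrier V" for v w
    using that by (simp add: quot_space_def B.a_rcos_sum)
  have add': "(B' +>\<^bsub>V'\<^esub> v) \<oplus>\<^bsub>?Q'\<^esub> (B' +>\<^bsub>V'\<^esub> w) = B' +>\<^bsub>V'\<^esub> (v \<oplus>\<^bsub>V'\<^esub> w)"
    if "v \<in> carrier V'" "w \<in> carrier V'" for v w
    using that by (simp add: quot_space_def B'.a_rcos_sum)
  note smult = quot_space_smult_coset[OF vs(1) B] quot_space_smult_coset[OF vs(2) B']
  define g where "g = ?f"
  have g: "g (B +>\<^bsub>V\<^esub> v) = B' +>\<^bsub>V'\<^esub> T v" if "v \<in> carrier V" for v
    unfolding g_def using that by (rule f)
  have "g \<in> LinearCombinations.module_hom K ?Q ?Q'"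
    unfolding LinearCombinations.module_hom_def
    by (auto simp: carrier add add' smult g) (use T.f_im in blast)
  moreover have Q: "vectorspace K ?Q" "vectorspace K ?Q'"
    using vs B B' by (auto intro: vectorspace_quot_space)
  ultimately have "mod_hom K ?Q ?Q' g"
    by (intro mod_hom.intro mod_hom_axioms.intro vectorspace.axioms(1))
  with Q show ?thesis unfolding g_def by (rule linear_map.intro)
qed

lemma bij_betw_quot_space:
  fixes V (structure) and V' (structure)
  assumes T: "linear_map K V V' T" and B: "subspace K B V" and B': "subspace K B' V'"
    and bij: "bij_betw T (carrier V) (carrier V')" and TB: "T ` B = B'"
  shows "bij_betw (\<lambda>X. \<Union>x\<in>X. B' +>\<^bsub>V'\<^esub> T x) (carrier (quot_space V B)) (carrier (quot_space V' B'))"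
    (is "bij_betw ?f _ _")
proof -
  interpret T: linear_map K V V' T by fact
  interpret B: submodule K B V using B by (simp add: subspace_def)
  note vs = T.V.vectorspace_axioms T.W.vectorspace_axioms
  interpret BV: abelian_subgroup B V using vs(1) B by (rule subspace_imp_abelian_subgroup)
  interpret B': abelian_subgroup B' V' using vs(2) B' by (rule subspace_imp_abelian_subgroup)
  note f = induced_map_coset[OF T B B' equalityD1[OF TB]]
  have carrier: "carrier (quot_space V B) = (\<lambda>v. B +>\<^bsub>V\<^esub> v) ` carrier V"
    "carrier (quot_space V' B') = (\<lambda>v. B' +>\<^bsub>V'\<^esub> v) ` carrier V'"
    by (auto simp: quot_space_def A_RCOSETS_def')
  have "B +>\<^bsub>V\<^esub> v = B +>\<^bsub>V\<^esub> w" if v: "v \<in> carrier V" and w: "w \<in> carrier V"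
    and eq: "B' +>\<^bsub>V'\<^esub> T v = B' +>\<^bsub>V'\<^esub> T w" for v w
  proof -
    \<comment> \<open>The difference of \<open>T w\<close> and \<open>T v\<close> lies in
      \<open>B'\<close>, hence is \<open>T b\<close> for some \<open>b\<close> in \<open>B\<close>;
      injectivity of \<open>T\<close> lifts this relation back to \<open>V\<close>.\<close>
    have "T w \<in> B' +>\<^bsub>V'\<^esub> T v" using w eq by (simp add: B'.a_rcos_self)
    then obtain b where b: "b \<in> B" "T w = T b \<oplus>\<^bsub>V'\<^esub> T v"
      using TB by (auto simp: a_r_coset_def')
    then have bV: "b \<in> carrier V" using B.subset by auto
    then have "T w = T (b \<oplus>\<^bsub>V\<^esub> v)" using b v by simp
    then have "w = b \<oplus>\<^bsub>V\<^esub> v"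
      using bV v w by (intro inj_onD[OF bij_betw_imp_inj_on[OF bij]]) auto
    then have "w \<in> B +>\<^bsub>V\<^esub> v" using b(1) by (auto simp: a_r_coset_def')
    then show ?thesis using coset_eqI[OF vs(1) B v] by simp
  qed
  note inj = this
  have "inj_on ?f (carrier (quot_space V B))"
  proof (rule inj_onI)
    fix X Y assume XY: "X \<in> carrier (quot_space V B)" "Y \<in> carrier (quot_space V B)" "?f X = ?f Y"
    then obtain v w where v: "v \<in> carrier V" "X = B +>\<^bsub>V\<^esub> v"
      and w: "w \<in> carrier V" "Y = B +>\<^bsub>V\<^esub> w"
      unfolding carrier by blast
    with XY(3) show "X = Y" by (simp only: f) (rule inj)
  qed
  moreover have "?f ` carrier (quot_space V B) = (\<lambda>v. B' +>\<^bsub>V'\<^esub> T v) ` carrier V"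
    unfolding carrier image_image using f by (rule image_cong[OF refl])
  moreover have "\<dots> = carrier (quot_space V' B')"
    unfolding carrier(2) bij_betw_imp_surj_on[OF bij, symmetric] image_image ..
  ultimately show ?thesis by (simp only: bij_betw_def)
qed

section \<open>Distraction of free modules\<close>

lemma free_space_simps:
  "carrier (free_space n) = carrier_vec n" "\<zero>\<^bsub>free_space n\<^esub> = 0\<^sub>v n"
  "u \<oplus>\<^bsub>free_space n\<^esub> v = u + v" "c \<odot>\<^bsub>free_space n\<^esub> v = Const c \<cdot>\<^sub>v v"
  by (simp_all add: free_space_def)

lemma module_free_mod:
  "Module.module class_ring
    (free_mod n :: (('n::{finite,linorder}, 'k::field) mpoly, ('n, 'k) mpoly vec) module)"
proof (rule moduleI)
  show "cring (class_ring :: ('n, 'k) mpoly ring)" by (rule class_cring.cring_axioms)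
  show "abelian_group (free_mod n :: (('n, 'k) mpoly, ('n, 'k) mpoly vec) module)"
  proof (rule abelian_groupI)
    fix v :: "('n, 'k) mpoly vec"
    assume "v \<in> carrier (free_mod n)"
    then show "\<exists>w\<in>carrier (free_mod n). w \<oplus>\<^bsub>free_mod n\<^esub> v = \<zero>\<^bsub>free_mod n\<^esub>"
      by (intro bexI[of _ "- v"]) (auto simp: module_vec_simps)
  qed (auto simp: module_vec_simps intro: comm_add_vec)
qed (auto simp: module_vec_simps add_smult_distrib_vec smult_add_distrib_vec smult_smult_assoc)

lemma vectorspace_free_space:
  "vectorspace class_ring (free_space n :: ('k::field, ('n::{finite,linorder}, 'k) mpoly vec) module)"
    (is "vectorspace _ ?V")
proof (rule vectorspace.intro)
  show "Module.module class_ring ?V"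
  proof (rule moduleI)
    show "cring (class_ring :: 'k ring)" by (rule class_cring.cring_axioms)
    show "abelian_group ?V"
    proof (rule abelian_groupI)
      fix v
      assume "v \<in> carrier ?V"
      then show "\<exists>w\<in>carrier ?V. w \<oplus>\<^bsub>?V\<^esub> v = \<zero>\<^bsub>?V\<^esub>"
        by (intro bexI[of _ "- v"]) (auto simp: free_space_simps)
    qed (auto simp: free_space_simps intro: comm_add_vec)
  qed (auto simp: free_space_simps add_smult_distrib_vec smult_add_distrib_vec smult_smult_assoc
      Const_add Const_mult)
  show "field (class_ring :: 'k ring)" by (rule class_field)
qed

text \<open>K acts through constant polynomials, so kernels and images of P-linear maps are also
  K-subspaces.\<close>

lemma subspace_free_space:
  assumes "LinearCombinations.submodule class_ring Z (free_mod n)"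
  shows "subspace class_ring Z (free_space n)"
proof -
  interpret Z: LinearCombinations.submodule class_ring Z "free_mod n" by fact
  show ?thesis
  proof (intro subspace.intro submodule.intro vectorspace_free_space
      vectorspace.axioms(1)[OF vectorspace_free_space])
    show "Z \<subseteq> carrier (free_space n)" using Z.subset by (simp add: free_space_simps module_vec_simps)
    show "\<zero>\<^bsub>free_space n\<^esub> \<in> Z" using Z.zero_closed by (simp add: free_space_simps module_vec_simps)
    fix v w assume v: "v \<in> Z"
    then show "c \<odot>\<^bsub>free_space n\<^esub> v \<in> Z" for c
      using Z.smult_closed[of "Const c" v] by (simp add: free_space_simps module_vec_simps)
    assume "w \<in> Z"
    with v show "v \<oplus>\<^bsub>free_space n\<^esub> w \<in> Z"
      using Z.m_closed[of v w] by (simp add: free_space_simps module_vec_simps)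
  qed
qed

lemma subspace_sub_space:
  assumes "subspace class_ring Z (free_space n)" "subspace class_ring B (free_space n)" "B \<subseteq> Z"
  shows "subspace class_ring B (sub_space n Z)"
proof -
  interpret B: LinearCombinations.submodule class_ring B "free_space n"
    using assms(2) by (simp add: subspace_def)
  have "vectorspace class_ring (sub_space n Z)"
    using vectorspace_free_space assms(1) by (rule vectorspace.subspace_is_vs)
  then show ?thesis
    by (intro subspace.intro submodule.intro vectorspace.axioms(1))
      (simp_all add: assms(3) B.m_closed B.smult_closed)
qed

section \<open>Kernels, images and matrices of P-linear maps\<close>

lemma mod_hom_free_mod:
  assumes "f \<in> LinearCombinations.module_hom class_ring (free_mod n) (free_mod m)"
  shows "mod_hom class_ring (free_mod n) (free_mod m) f"
  using assms by (intro mod_hom.intro mod_hom_axioms.intro module_free_mod)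

lemma hom_ker_eq:
  assumes "f \<in> LinearCombinations.module_hom class_ring (free_mod n) (free_mod m)"
  shows "hom_ker n m f = {v \<in> carrier_vec n. f v = 0\<^sub>v m}"
  by (simp add: hom_ker_def mod_hom.ker_def[OF mod_hom_free_mod[OF assms]] module_vec_simps)

lemma hom_im_eq:
  assumes "f \<in> LinearCombinations.module_hom class_ring (free_mod n) (free_mod m)"
  shows "hom_im n f = f ` carrier_vec n"
  by (simp add: hom_im_def mod_hom.im_def[OF mod_hom_free_mod[OF assms]] module_vec_simps)

lemma subspace_hom_ker:
  assumes "f \<in> LinearCombinations.module_hom class_ring (free_mod n) (free_mod m)"
  shows "subspace class_ring (hom_ker n m f) (free_space n)"
  unfolding hom_ker_def by (intro subspace_free_space mod_hom.ker_is_submodule mod_hom_free_mod assms)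

lemma subspace_hom_im:
  assumes "f \<in> LinearCombinations.module_hom class_ring (free_mod n) (free_mod m)"
  shows "subspace class_ring (hom_im n f) (free_space m)"
  unfolding hom_im_def by (intro subspace_free_space mod_hom.im_is_submodule mod_hom_free_mod assms)

lemma module_hom_mult_mat_vec:
  fixes A :: "('n::{finite,linorder}, 'k::field) mpoly mat"
  assumes "A \<in> carrier_mat m n"
  shows "(\<lambda>v. A *\<^sub>v v) \<in> LinearCombinations.module_hom class_ring (free_mod n) (free_mod m)"
proof -
  have "A *\<^sub>v (p \<cdot>\<^sub>v v) = p \<cdot>\<^sub>v (A *\<^sub>v v)" if "v \<in> carrier_vec n" for p v
    using assms that by (intro eq_vecI) auto
  then show ?thesis
    using assms unfolding LinearCombinations.module_hom_def
    by (auto simp: module_vec_simps mult_add_distrib_mat_vec)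
qed

lemma module_hom_index:
  fixes f :: "('n::{finite,linorder}, 'k::field) mpoly vec \<Rightarrow> ('n, 'k) mpoly vec"
  assumes f: "f \<in> LinearCombinations.module_hom class_ring (free_mod n) (free_mod m)"
    and v: "v \<in> carrier_vec n" and i: "i < m"
  shows "f v $ i = (\<Sum>j<n. v $ j * f (unit_vec n j) $ i)"
proof -
  \<comment> \<open>\<open>w k\<close> keeps only the first \<open>k\<close> coordinates of
    \<open>v\<close>, so its image realises the \<open>k\<close>-th partial sum.\<close>
  define w where "w k = vec n (\<lambda>j. if j < k then v $ j else 0)" for k
  have w: "w k \<in> carrier_vec n" for k by (simp add: w_def)
  have closed: "f u \<in> carrier_vec m" if "u \<in> carrier_vec n" for u
    using LinearCombinations.module_hom_closed[OF f] that by (auto simp: module_vec_simps)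
  have add: "f (u + u') = f u + f u'" if "u \<in> carrier_vec n" "u' \<in> carrier_vec n" for u u'
    using LinearCombinations.module_hom_add[OF f] that by (simp add: module_vec_simps)
  have smult: "f (p \<cdot>\<^sub>v u) = p \<cdot>\<^sub>v f u" if "u \<in> carrier_vec n" for p u
    using LinearCombinations.module_hom_smult[OF f] that by (simp add: module_vec_simps)
  have "f (w k) $ i = (\<Sum>j<k. v $ j * f (unit_vec n j) $ i)" if "k \<le> n" for k
    using that
  proof (induction k)
    case 0
    \<comment> \<open>Writing the zero vector as a zero multiple of itself lets compatibility with
      scalars show that its image vanishes.\<close>
    have "w 0 = 0 \<cdot>\<^sub>v w 0" by (intro eq_vecI) (simp_all add: w_def)
    then have "f (w 0) = 0 \<cdot>\<^sub>v f (w 0)" using smult[OF w] by metis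
    moreover have "(0 \<cdot>\<^sub>v f (w 0)) $ i = 0"
      using carrier_vecD[OF closed[OF w, of 0]] i by simp
    ultimately show ?case by simp
  next
    case (Suc k)
    have "w (Suc k) = w k + v $ k \<cdot>\<^sub>v unit_vec n k"
      using Suc.prems by (intro eq_vecI) (auto simp: w_def unit_vec_def less_Suc_eq)
    then have "f (w (Suc k)) = f (w k) + v $ k \<cdot>\<^sub>v f (unit_vec n k)"
      using w by (simp add: add smult)
    then show ?case
      using Suc i closed[OF unit_vec_carrier, of k] by (auto simp: closed[OF w])
  qed
  from this[of n] have "f (w n) $ i = (\<Sum>j<n. v $ j * f (unit_vec n j) $ i)" by simp
  moreover have "w n = v" using v by (intro eq_vecI) (auto simp: w_def)
  ultimately show ?thesis by simp
qed

section \<open>Distraction of free modules by coordinates\<close>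

lemma distraction_free_closed [simp]: "distraction_free L ts v \<in> carrier_vec (length ts)"
  by (simp add: distraction_free_def)

lemma dim_distraction_free [simp]: "dim_vec (distraction_free L ts v) = length ts"
  by (simp add: distraction_free_def)

text \<open>D(t_i) is a nonzero factor of D(t t_i), and its cofactor is the distraction of
  \<open>t\<close> for the matrix shifted by t_i; this cofactor is what \<open>div0\<close>
  returns.\<close>

lemma distraction_free_index:
  assumes "distraction_matrix L" "i < length ts"
  shows "distraction_free L ts v $ i = distraction_poly (shift_matrix L (ts ! i)) (v $ i)"
proof -
  have "distraction_pp L (t + ts ! i) div0 distraction_pp L (ts ! i) =
      distraction_pp (shift_matrix L (ts ! i)) t" for t
    by (simp only: add.commute[of t] distraction_pp_add mult.commute[of "distraction_pp L (ts ! i)"]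
        div0_eq[OF distraction_pp_nonzero[OF assms(1)]])
  then show ?thesis
    using assms(2) by (simp add: distraction_free_def distraction_poly_def)
qed

lemma distraction_free_add:
  assumes "distraction_matrix L" "v \<in> carrier_vec (length ts)" "w \<in> carrier_vec (length ts)"
  shows "distraction_free L ts (v + w) = distraction_free L ts v + distraction_free L ts w"
  using assms
  by (intro eq_vecI) (simp_all add: distraction_free_index distraction_poly_add)

lemma distraction_free_smult:
  assumes "distraction_matrix L" "v \<in> carrier_vec (length ts)"
  shows "distraction_free L ts (Const c \<cdot>\<^sub>v v) = Const c \<cdot>\<^sub>v distraction_free L ts v"
  using assms
  by (intro eq_vecI) (simp_all add: distraction_free_index distraction_poly_Const_mult)

text \<open>Each coordinate is distracted by its own shifted matrix, again a distraction matrix, so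
  injectivity and the choice of preimages are coordinatewise.\<close>

lemma bij_betw_distraction_free:
  fixes L :: "'n::{finite,linorder} \<Rightarrow> nat \<Rightarrow> ('n, 'k::field) mpoly"
  assumes L: "distraction_matrix L"
  shows "bij_betw (distraction_free L ts) (carrier_vec (length ts)) (carrier_vec (length ts))"
proof (rule bij_betwI')
  note bij = bij_distraction_poly[OF distraction_matrix_shift[OF L]]
  fix v w :: "('n, 'k) mpoly vec"
  assume v: "v \<in> carrier_vec (length ts)"
  then show "distraction_free L ts v \<in> carrier_vec (length ts)" by simp
  assume w: "w \<in> carrier_vec (length ts)"
  have "v = w" if eq: "distraction_free L ts v = distraction_free L ts w"
  proof (rule eq_vecI)
    fix i assume "i < dim_vec w"
    then have i: "i < length ts" using w by simp
    show "v $ i = w $ i"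
      by (rule injD[OF bij_is_inj[OF bij, of "ts ! i"]])
        (simp only: eq flip: distraction_free_index[OF L i])
  qed (use v w in simp)
  then show "distraction_free L ts v = distraction_free L ts w \<longleftrightarrow> v = w" by blast
next
  note bij = bij_distraction_poly[OF distraction_matrix_shift[OF L]]
  fix w :: "('n, 'k) mpoly vec"
  assume w: "w \<in> carrier_vec (length ts)"
  define v where "v = vec (length ts) (\<lambda>i. inv_into UNIV (distraction_poly (shift_matrix L (ts ! i))) (w $ i))"
  have "w = distraction_free L ts v"
    using w
    by (intro eq_vecI)
      (simp_all add: distraction_free_index[OF L] v_def surj_f_inv_f[OF bij_is_surj[OF bij]])
  then show "\<exists>v\<in>carrier_vec (length ts). w = distraction_free L ts v"
    by (intro bexI[of _ v]) (simp_all add: v_def)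
qed

section \<open>Commutativity of the diagram\<close>

lemma module_hom_distraction_hom:
  "distraction_hom L ts ts' \<phi> \<in>
     LinearCombinations.module_hom class_ring (free_mod (length ts)) (free_mod (length ts'))"
  unfolding distraction_hom_def by (rule module_hom_mult_mat_vec) simp

text \<open>
  If \<open>t'\<^sub>i\<close> does not divide \<open>t\<^sub>j\<close>, then \<open>c\<^sub>i\<^sub>j = 0\<close> by definition of \<open>hom_coeff\<close>, so it does not matter
  whether \<open>D(t'\<^sub>i)\<close> divides \<open>D(t\<^sub>j)\<close>.
\<close>

lemma distraction_poly_entry:
  fixes \<phi> :: "('n::{finite,linorder}, 'k::field) mpoly vec \<Rightarrow> ('n, 'k) mpoly vec"
  assumes L: "distraction_matrix L" and \<phi>: "graded_hom ts ts' \<phi>"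
    and j: "j < length ts" and i: "i < length ts'"
  shows "distraction_poly (shift_matrix L (ts' ! i)) (p * \<phi> (unit_vec (length ts) j) $ i) =
    Const (hom_coeff ts ts' \<phi> i j) * (distraction_pp L (ts ! j) div0 distraction_pp L (ts' ! i)) *
      distraction_poly (shift_matrix L (ts ! j)) p"
proof (cases "\<exists>u. ts ! j = u + ts' ! i")
  case True
  then obtain u where u: "ts ! j = u + ts' ! i" by blast
  have nz: "pp_poly (ts' ! i) \<noteq> (0 :: ('n, 'k) mpoly)"
    by (metis pp_poly_def lookup_single_eq lookup_zero zero_neq_one)
  have "(pp_poly (ts ! j) :: ('n, 'k) mpoly) div0 pp_poly (ts' ! i) = pp_poly u"
    using div0_eq[OF nz] by (simp add: u flip: pp_poly_mult)
  then have \<phi>_eq: "\<phi> (unit_vec (length ts) j) $ i = Const (hom_coeff ts ts' \<phi> i j) * pp_poly u"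
    using graded_hom_matrix[OF \<phi> j i] by simp
  have "distraction_pp L (ts ! j) = distraction_pp (shift_matrix L (ts' ! i)) u * distraction_pp L (ts' ! i)"
    by (simp add: u distraction_pp_add[of L "ts' ! i", symmetric] mult.commute add.commute)
  then have "distraction_pp L (ts ! j) div0 distraction_pp L (ts' ! i) =
      distraction_pp (shift_matrix L (ts' ! i)) u"
    using div0_eq[OF distraction_pp_nonzero[OF L]] by simp
  \<comment> \<open>Splitting off \<open>u\<close> shifts the matrix once more; the two shifts, by
    \<open>ts' ! i\<close> and by \<open>u\<close>, add up to the shift by
    \<open>ts ! j\<close>.\<close>
  then show ?thesis
    by (simp only: \<phi>_eq mult.left_commute[of p] distraction_poly_Const_mult
      distraction_poly_pp_poly_mult shift_matrix_shift mult.assoc flip: u)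
next
  case False
  then have "\<not> (pp_poly (ts' ! i) :: ('n, 'k) mpoly) dvd pp_poly (ts ! j)"
    by (simp add: pp_poly_dvd_iff)
  then have "\<phi> (unit_vec (length ts) j) $ i = 0"
    using graded_hom_matrix[OF \<phi> j i] by (simp add: quot_or_zero_def)
  then show ?thesis by (simp add: hom_coeff_def)
qed

text \<open>Since D is only K-linear, the coordinates of \<open>v\<close> cannot be pulled out of
  it. They enter \<open>distraction_poly_entry\<close> as the arbitrary factor \<open>p\<close>, and
  summing over \<open>j\<close> gives the matrix product.\<close>

lemma distraction_free_hom:
  assumes L: "distraction_matrix L" and \<phi>: "graded_hom ts ts' \<phi>" and v: "v \<in> carrier_vec (length ts)"
  shows "distraction_free L ts' (\<phi> v) = distraction_hom L ts ts' \<phi> (distraction_free L ts v)"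
proof (rule eq_vecI)
  have hom: "\<phi> \<in> LinearCombinations.module_hom class_ring (free_mod (length ts)) (free_mod (length ts'))"
    using \<phi> by (simp add: graded_hom_def)
  fix i assume "i < dim_vec (distraction_hom L ts ts' \<phi> (distraction_free L ts v))"
  then have i: "i < length ts'" by (simp add: distraction_hom_def)
  have "distraction_free L ts' (\<phi> v) $ i = (\<Sum>j<length ts.
      distraction_poly (shift_matrix L (ts' ! i)) (v $ j * \<phi> (unit_vec (length ts) j) $ i))"
    by (simp only: distraction_free_index[OF L i] module_hom_index[OF hom v i] distraction_poly_sum)
  also have "\<dots> = (\<Sum>j<length ts. Const (hom_coeff ts ts' \<phi> i j) *
      (distraction_pp L (ts ! j) div0 distraction_pp L (ts' ! i)) * distraction_free L ts v $ j)"
    by (intro sum.cong refl)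
      (simp only: lessThan_iff distraction_poly_entry[OF L \<phi> _ i] distraction_free_index[OF L])
  also have "\<dots> = distraction_hom L ts ts' \<phi> (distraction_free L ts v) $ i"
    using i by (simp add: distraction_hom_def scalar_prod_def lessThan_atLeast0
      cong: sum.cong_simp)
  finally show "distraction_free L ts' (\<phi> v) $ i = \<dots>" .
qed (simp add: distraction_hom_def)

section \<open>Compatibility with the standard degree\<close>

lemma keys_distraction_pp:
  assumes "distraction_matrix L" "s \<in> Poly_Mapping.keys (distraction_pp L t)"
  shows "pp_deg s = pp_deg t"
  using assms
proof (induction "pp_deg t" arbitrary: L s t)
  case 0
  then have "t = 0" by (intro poly_mapping_eqI) (auto simp: pp_deg_def)
  then show ?case using 0 by (simp add: distraction_pp_def pp_deg_def)
next
  case (Suc m)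
  obtain i u where t: "t = Poly_Mapping.single i 1 + u" "pp_deg u = m"
    using Suc.hyps(2)[symmetric] by (rule pp_deg_eq_SucE)
  \<comment> \<open>Splitting off one linear form leaves the distraction of \<open>u\<close> by a
    shifted matrix, which is why the induction is over all \<open>L\<close>.\<close>
  have "distraction_pp L t =
      L i 1 * distraction_pp (shift_matrix L (Poly_Mapping.single i 1)) u"
    by (simp only: t(1) distraction_pp_add distraction_pp_single)
  then obtain a b where s: "s = a + b" and a: "a \<in> Poly_Mapping.keys (L i 1)"
    and b: "b \<in> Poly_Mapping.keys (distraction_pp (shift_matrix L (Poly_Mapping.single i 1)) u)"
    using Suc.prems(2) keys_mult[of "L i 1"] by fastforce
  have "L i 1 \<in> linear_forms"
    using Suc.prems(1) by (simp add: distraction_matrix_def)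
  then have "pp_deg a = 1" using a by (simp add: linear_forms_def)
  moreover have "pp_deg b = pp_deg u"
    by (rule Suc.hyps(1)[OF t(2)[symmetric] distraction_matrix_shift[OF Suc.prems(1)] b])
  ultimately show ?case using t(2) Suc.hyps(2) by (simp add: s pp_deg_add)
qed

text \<open>A coefficient of D(p) is nonzero only if some power product of \<open>p\<close>
  contributes to it, and D preserves the degree of each contribution.\<close>

lemma keys_distraction_poly:
  assumes "distraction_matrix L" "s \<in> Poly_Mapping.keys (distraction_poly L p)"
  shows "\<exists>t\<in>Poly_Mapping.keys p. pp_deg s = pp_deg t"
proof -
  have "(\<Sum>t\<in>Poly_Mapping.keys p. Poly_Mapping.lookup p t * Poly_Mapping.lookup (distraction_pp L t) s) \<noteq> 0"
    using assms(2) by (simp add: distraction_poly_def in_keys_iff lookup_sum lookup_Const_mult)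
  then obtain t where "t \<in> Poly_Mapping.keys p" "Poly_Mapping.lookup (distraction_pp L t) s \<noteq> 0"
    by (metis (no_types, lifting) mult_zero_right sum.neutral)
  then show ?thesis
    using keys_distraction_pp[OF assms(1)] by (auto simp: in_keys_iff)
qed

text \<open>Shifting the matrix by t_i does not affect degrees: D(t t_i)/D(t_i) still has the degree
  of \<open>t\<close>, and the same d_i is added before and after.\<close>

lemma std_homogeneous_distraction_free:
  assumes "distraction_matrix L" "std_homogeneous (map pp_deg ts) d v"
  shows "std_homogeneous (map pp_deg ts) d (distraction_free L ts v)"
  unfolding std_homogeneous_def
proof (intro conjI allI impI ballI)
  fix i s
  assume i: "i < length (map pp_deg ts)"
    and s: "s \<in> Poly_Mapping.keys (distraction_free L ts v $ i)"
  then have "s \<in> Poly_Mapping.keys (distraction_poly (shift_matrix L (ts ! i)) (v $ i))"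
    by (simp add: distraction_free_index[OF assms(1)])
  then obtain t where "t \<in> Poly_Mapping.keys (v $ i)" "pp_deg s = pp_deg t"
    using keys_distraction_poly[OF distraction_matrix_shift[OF assms(1)]] by blast
  then show "pp_deg s + map pp_deg ts ! i = d"
    using assms(2) i by (simp add: std_homogeneous_def)
qed simp

section \<open>The map on homology\<close>

lemma linear_map_distraction_free:
  assumes L: "distraction_matrix L"
    and Z: "subspace class_ring Z (free_space (length ts))"
    and Z': "subspace class_ring Z' (free_space (length ts))"
    and "distraction_free L ts ` Z \<subseteq> Z'"
  shows "linear_map class_ring (sub_space (length ts) Z) (sub_space (length ts) Z') (distraction_free L ts)"
proof -
  have "Z \<subseteq> carrier_vec (length ts)"
    using LinearCombinations.submodule.subset[OF subspace.submod[OF Z]] by (simp add: free_space_simps)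
  then have "distraction_free L ts \<in>
      LinearCombinations.module_hom class_ring (sub_space (length ts) Z) (sub_space (length ts) Z')"
    using assms(4) unfolding LinearCombinations.module_hom_def
    by (auto simp: free_space_simps subset_iff distraction_free_add[OF L] distraction_free_smult[OF L])
  moreover have vs: "vectorspace class_ring (sub_space (length ts) Z)"
    "vectorspace class_ring (sub_space (length ts) Z')"
    using vectorspace.subspace_is_vs[OF vectorspace_free_space] Z Z' by blast+
  ultimately have "mod_hom class_ring (sub_space (length ts) Z) (sub_space (length ts) Z') (distraction_free L ts)"
    by (intro mod_hom.intro mod_hom_axioms.intro vectorspace.axioms(1))
  with vs show ?thesis by (rule linear_map.intro)
qed

text \<open>Restricting the carrier leaves addition unchanged. This reconciles the quotient lemmas,
  applied inside the kernels, with \<open>induced_map\<close>, which takes cosets in the whole free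
  module.\<close>

lemma coset_sub_space: "B +>\<^bsub>sub_space r Z\<^esub> v = B +>\<^bsub>free_space r\<^esub> v"
  by (simp add: a_r_coset_def')

theorem theorem2p19:
  fixes L :: "'n::{finite,linorder} \<Rightarrow> nat \<Rightarrow> ('n, 'k::field) mpoly"
    and ts'' ts ts' :: "'n pp list"
    and \<psi> \<phi> :: "('n, 'k) mpoly vec \<Rightarrow> ('n, 'k) mpoly vec"
  defines "r'' \<equiv> length ts''" and "r \<equiv> length ts" and "r' \<equiv> length ts'"
    and "D'' \<equiv> distraction_free L ts''" and "D \<equiv> distraction_free L ts"
    and "D' \<equiv> distraction_free L ts'"
    and "D\<psi> \<equiv> distraction_hom L ts'' ts \<psi>" and "D\<phi> \<equiv> distraction_hom L ts ts' \<phi>"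
  defines "H \<equiv> subquotient r (hom_ker r r' \<phi>) (hom_im r'' \<psi>)"
    and "DH \<equiv> subquotient r (hom_ker r r' D\<phi>) (hom_im r'' D\<psi>)"
    and "Dbar \<equiv> induced_map r (hom_im r'' D\<psi>) D"
  assumes "infinite (UNIV :: 'k set)"
    and "distraction_matrix L"
    and "graded_hom ts'' ts \<psi>" and "graded_hom ts ts' \<phi>"
    and "\<forall>u\<in>carrier_vec r''. \<phi> (\<psi> u) = 0\<^sub>v r'"
  shows
    "((\<forall>u\<in>carrier_vec r''. D (\<psi> u) = D\<psi> (D'' u)) \<and>
      (\<forall>v\<in>carrier_vec r. D' (\<phi> v) = D\<phi> (D v))) \<and>
     (D ` hom_ker r r' \<phi> = hom_ker r r' D\<phi> \<and> D' ` hom_im r \<phi> = hom_im r D\<phi>) \<and>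
     (hom_im r'' \<psi> \<subseteq> hom_ker r r' \<phi> \<and> hom_im r'' D\<psi> \<subseteq> hom_ker r r' D\<phi> \<and>
      linear_map class_ring H DH Dbar \<and>
      (\<forall>v\<in>hom_ker r r' \<phi>. Dbar (hom_im r'' \<psi> +>\<^bsub>free_space r\<^esub> v) = hom_im r'' D\<psi> +>\<^bsub>free_space r\<^esub> D v) \<and>
      (\<forall>d. Dbar ` subquotient_component (map pp_deg ts) (hom_ker r r' \<phi>) (hom_im r'' \<psi>) d
             \<subseteq> subquotient_component (map pp_deg ts) (hom_ker r r' D\<phi>) (hom_im r'' D\<psi>) d)) \<and>
     bij_betw Dbar (carrier H) (carrier DH)"
proof -
  let ?hom = "\<lambda>n m. LinearCombinations.module_hom class_ring (free_mod n) (free_mod m)"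
  note L = \<open>distraction_matrix L\<close> and \<psi> = \<open>graded_hom ts'' ts \<psi>\<close> and \<phi> = \<open>graded_hom ts ts' \<phi>\<close>
  have \<psi>_hom: "\<psi> \<in> ?hom r'' r" and \<phi>_hom: "\<phi> \<in> ?hom r r'"
    using \<psi> \<phi> by (simp_all add: graded_hom_def r''_def r_def r'_def)
  have D\<psi>_hom: "D\<psi> \<in> ?hom r'' r" and D\<phi>_hom: "D\<phi> \<in> ?hom r r'"
    unfolding D\<psi>_def D\<phi>_def r''_def r_def r'_def by (rule module_hom_distraction_hom)+
  have bij'': "bij_betw D'' (carrier_vec r'') (carrier_vec r'')"
    and bij: "bij_betw D (carrier_vec r) (carrier_vec r)"
    and bij': "bij_betw D' (carrier_vec r') (carrier_vec r')"
    unfolding D''_def D_def D'_def r''_def r_def r'_def by (rule bij_betw_distraction_free[OF L])+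
  have comm\<psi>: "D (\<psi> u) = D\<psi> (D'' u)" if "u \<in> carrier_vec r''" for u
    using that unfolding D_def D\<psi>_def D''_def r''_def by (rule distraction_free_hom[OF L \<psi>])
  have comm\<phi>: "D' (\<phi> v) = D\<phi> (D v)" if "v \<in> carrier_vec r" for v
    using that unfolding D_def D\<phi>_def D'_def r_def by (rule distraction_free_hom[OF L \<phi>])
  let ?Z = "hom_ker r r' \<phi>" and ?DZ = "hom_ker r r' D\<phi>"
  let ?B = "hom_im r'' \<psi>" and ?DB = "hom_im r'' D\<psi>"
  note ker = hom_ker_eq[OF \<phi>_hom] hom_ker_eq[OF D\<phi>_hom]
  note im = hom_im_eq[OF \<psi>_hom] hom_im_eq[OF D\<psi>_hom]
  have D'_0: "D' (0\<^sub>v r') = 0\<^sub>v r'"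
    unfolding D'_def r'_def by (intro eq_vecI) (simp_all add: distraction_free_index[OF L])
  have \<phi>_closed: "\<phi> v \<in> carrier_vec r'" if "v \<in> carrier_vec r" for v
    using LinearCombinations.module_hom_closed[OF \<phi>_hom] that by (auto simp: module_vec_simps)
  have \<psi>_closed: "\<psi> u \<in> carrier_vec r" if "u \<in> carrier_vec r''" for u
    using LinearCombinations.module_hom_closed[OF \<psi>_hom] that by (auto simp: module_vec_simps)
  \<comment> \<open>By commutativity the left side says that \<open>D'\<close> kills
    \<open>\<phi> v\<close>; as \<open>D'\<close> is injective and fixes zero, this means
    \<open>\<phi> v\<close> is zero.\<close>
  have ker_iff: "D\<phi> (D v) = 0\<^sub>v r' \<longleftrightarrow> \<phi> v = 0\<^sub>v r'" if v: "v \<in> carrier_vec r" for v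
    using inj_on_eq_iff[OF bij_betw_imp_inj_on[OF bij'] \<phi>_closed[OF v] zero_carrier_vec]
    by (simp add: D'_0 flip: comm\<phi>[OF v])
  have DZ: "D ` ?Z = ?DZ"
  proof (intro equalityI subsetI)
    fix w assume "w \<in> D ` ?Z"
    then show "w \<in> ?DZ"
      using bij_betwE[OF bij] by (auto simp: ker ker_iff)
  \<comment> \<open>This inclusion uses surjectivity of \<open>D\<close>, which writes an element of
    the distracted kernel as some \<open>D v\<close>.\<close>
  next
    fix w assume w: "w \<in> ?DZ"
    then obtain v where "v \<in> carrier_vec r" "w = D v"
      using bij_betw_imp_surj_on[OF bij] by (auto simp: ker)
    with w show "w \<in> D ` ?Z" by (auto simp: ker ker_iff)
  qed
  \<comment> \<open>Precomposing with the bijection \<open>E\<close> does not change the set of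
    values of \<open>g\<close>. Used for both \<phi> and \<psi>.\<close>
  have im_comm: "E' ` (f ` carrier_vec n) = g ` carrier_vec n"
    if "\<And>v. v \<in> carrier_vec n \<Longrightarrow> E' (f v) = g (E v)" "bij_betw E (carrier_vec n) (carrier_vec n)"
    for E E' f g :: "('n, 'k) mpoly vec \<Rightarrow> ('n, 'k) mpoly vec" and n
  proof -
    have "E' ` (f ` carrier_vec n) = g ` (E ` carrier_vec n)"
      unfolding image_image using that(1) by (rule image_cong[OF refl])
    then show ?thesis by (simp only: bij_betw_imp_surj_on[OF that(2)])
  qed
  have D_im: "D' ` hom_im r \<phi> = hom_im r D\<phi>"
    unfolding hom_im_eq[OF \<phi>_hom] hom_im_eq[OF D\<phi>_hom] using comm\<phi> bij by (rule im_comm)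
  have DB: "D ` ?B = ?DB"
    unfolding im using comm\<psi> bij'' by (rule im_comm)
  have BZ: "?B \<subseteq> ?Z"
    using \<open>\<forall>u\<in>carrier_vec r''. \<phi> (\<psi> u) = 0\<^sub>v r'\<close> \<psi>_closed by (auto simp: im ker)
  \<comment> \<open>That the bottom row is again a complex follows by applying \<open>D\<close> to
    the inclusion \<open>BZ\<close>.\<close>
  have DBZ: "?DB \<subseteq> ?DZ"
    unfolding DB[symmetric] DZ[symmetric] using BZ by (rule image_mono)
  note Z = subspace_hom_ker[OF \<phi>_hom] and Z' = subspace_hom_ker[OF D\<phi>_hom]
  have B: "subspace class_ring ?B (sub_space r ?Z)"
    using Z subspace_hom_im[OF \<psi>_hom] BZ by (rule subspace_sub_space)
  have B': "subspace class_ring ?DB (sub_space r ?DZ)"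
    using Z' subspace_hom_im[OF D\<psi>_hom] DBZ by (rule subspace_sub_space)
  have lin: "linear_map class_ring (sub_space r ?Z) (sub_space r ?DZ) D"
    unfolding D_def r_def
    by (rule linear_map_distraction_free[OF L])
      (use Z Z' DZ in \<open>simp_all add: r_def D_def\<close>)
  have Dbar: "Dbar = (\<lambda>X. \<Union>x\<in>X. ?DB +>\<^bsub>sub_space r ?DZ\<^esub> D x)"
    by (rule ext) (simp add: Dbar_def induced_map_def coset_sub_space)
  have Dbar_coset: "Dbar (?B +>\<^bsub>free_space r\<^esub> v) = ?DB +>\<^bsub>free_space r\<^esub> D v" if "v \<in> ?Z" for v
    using induced_map_coset[OF lin B B' equalityD1[OF DB], of v] that
    by (simp add: Dbar coset_sub_space)
  have Dbar_linear: "linear_map class_ring H DH Dbar"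
    unfolding H_def DH_def Dbar using lin B B' equalityD1[OF DB] by (rule linear_map_quot_space)
  have Dbar_bij: "bij_betw Dbar (carrier H) (carrier DH)"
  proof -
    \<comment> \<open>On the kernel, injectivity is inherited from \<open>D\<close> on the whole
      module, and \<open>DZ\<close> identifies the image.\<close>
    have "?Z \<subseteq> carrier_vec r" by (auto simp: ker)
    then have "bij_betw D ?Z ?DZ" using bij DZ by (auto intro: bij_betw_subset)
    then have "bij_betw D (carrier (sub_space r ?Z)) (carrier (sub_space r ?DZ))" by simp
    then show ?thesis
      unfolding H_def DH_def Dbar using DB by (rule bij_betw_quot_space[OF lin B B'])
  qed
  have Dbar_component: "Dbar ` subquotient_component (map pp_deg ts) ?Z ?B d
      \<subseteq> subquotient_component (map pp_deg ts) ?DZ ?DB d" for d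
  proof
    fix Y assume "Y \<in> Dbar ` subquotient_component (map pp_deg ts) ?Z ?B d"
    then obtain v where v: "v \<in> ?Z" "std_homogeneous (map pp_deg ts) d v"
      and Y: "Y = Dbar (?B +>\<^bsub>free_space r\<^esub> v)"
      by (auto simp: subquotient_component_def r_def)
    have "std_homogeneous (map pp_deg ts) d (D v)"
      unfolding D_def using L v(2) by (rule std_homogeneous_distraction_free)
    moreover have "D v \<in> ?DZ" using v(1) DZ by blast
    ultimately show "Y \<in> subquotient_component (map pp_deg ts) ?DZ ?DB d"
      using Dbar_coset[OF v(1)] Y by (auto simp: subquotient_component_def r_def)
  qed
  show ?thesis
    by (intro conjI ballI allI comm\<psi> comm\<phi> DZ D_im BZ DBZ Dbar_linear Dbar_coset
        Dbar_component Dbar_bij)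
qed

end
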